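(* Let $e\ge2$ and let $\lambda$ be a nonempty partition of $n$. Then $\mathrm{sh}_e(\mathrm{gr}(\omega_\lambda))=\mathrm{sh}_e(\mathrm{gr}(\omega_{\mathrm{reg}_e(\lambda)}))$ and $\mathrm{sh}_e(\mathrm{gr}(\tilde\omega_\lambda))=\mathrm{sh}_e(\mathrm{gr}(\tilde\omega_{\mathrm{reg}_e(\lambda)}))$.
   Context: A partition of $n$ is a non-increasing sequence $\lambda=(\lambda_1\ge\dots\ge\lambda_h>0)$ of positive integers with sum $n$; $Y(\lambda)=\{(a,b):1\le a\le h,1\le b\le\lambda_a\}$. Node $(a,b)$ corresponds to the closed square with vertices $(a-b,a+b),(a-b\pm1,a+b-1),(a-b,a+b-2)$; $\omega_\lambda(x)=\max(|x|,\sup\{y:(x,y)\text{ lies in one of these squares}\})$ and $\tilde\omega_\lambda(s)=n^{-1/2}\omega_\lambda(s\sqrt n)$. The $e$-ladder number of a node $(a,b)$ is $a+(e-1)(b-1)$; $\mathrm{reg}_e(\lambda)$ is obtained by moving each node of $Y(\lambda)$ to the highest possible position (smallest row index) among nodes of the same ladder number. For a continuous $g:\mathbb R\to\mathbb R$ with $g\ge|\cdot|$, $g(x)=|x|$ for $|x|$ large and $g\ne|\cdot|$: $a_g=\inf\{x:g(x)\ne|x|\}$, $b_g=\sup\{x:g(x)\ne|x|\}$, $\mathrm{gr}(g)=\{(x,y)\in[a_g,b_g]\times\mathbb R_{\ge0}:|x|\le y\le g(x)\}$. Shaking: for $\alpha\ge0$, $D$ the line $y=-x$, $v_\alpha$ the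 unit vector positively collinear to $(1,\alpha)$; for compact $K\subseteq\mathbb R^2$, $\mathrm{Sh}_\alpha(K)=\bigcup_{p\in D}K^p$ with $K^p=\emptyset$ if $K\cap(p+\mathbb Rv_\alpha)=\emptyset$ and otherwise the segment from $p$ to $p+|K\cap(p+\mathbb Rv_\alpha)|\,v_\alpha$ ($|\cdot|$ one-dimensional Lebesgue measure). $\mathrm{sh}_e=\mathrm{Sh}_{1-2e^{-1}}$. *)

theory Defs
  imports "HOL-Analysis.Analysis"
begin

text \<open>Partitions are lists of positive naturals in non-increasing order.\<close>
definition is_partition :: "nat list \<Rightarrow> nat \<Rightarrow> bool" where
  "is_partition lam n \<longleftrightarrow> sorted_wrt (\<ge>) lam \<and> (\<forall>x\<in>set lam. 0 < x) \<and> sum_list lam = n"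

text \<open>Young diagram, nodes (a,b) with 1-based row a and column b.\<close>
definition young :: "nat list \<Rightarrow> (nat \<times> nat) set" where
  "young lam = {(a,b). 1 \<le> a \<and> a \<le> length lam \<and> 1 \<le> b \<and> b \<le> lam ! (a - 1)}"

text \<open>The closed square attached to node (a,b): vertices (a-b,a+b), (a-b+-1,a+b-1), (a-b,a+b-2).\<close>
definition node_square :: "nat \<times> nat \<Rightarrow> (real \<times> real) set" where
  "node_square p = (case p of (a,b) \<Rightarrow>
     {(x,y). \<bar>x - (real a - real b)\<bar> + \<bar>y - (real a + real b - 1)\<bar> \<le> 1})"

text \<open>Profile of a diagram given as a set of nodes:
  omega(x) = max(|x|, sup{y. (x,y) in some square}), with the sup ignored when empty.\<close>
definition omega_nodes :: "(nat \<times> nat) set \<Rightarrow> real \<Rightarrow> real" where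
  "omega_nodes Y x = (let S = {y. \<exists>p\<in>Y. (x,y) \<in> node_square p} in
     if S = {} then \<bar>x\<bar> else max \<bar>x\<bar> (Sup S))"

definition omega :: "nat list \<Rightarrow> real \<Rightarrow> real" where
  "omega lam = omega_nodes (young lam)"

text \<open>Rescaled profile omega~(s) = n^(-1/2) omega(s sqrt n); n is the size of the partition.\<close>
definition omega_tilde_nodes :: "nat \<Rightarrow> (nat \<times> nat) set \<Rightarrow> real \<Rightarrow> real" where
  "omega_tilde_nodes n Y s = omega_nodes Y (s * sqrt (real n)) / sqrt (real n)"

definition omega_tilde :: "nat \<Rightarrow> nat list \<Rightarrow> real \<Rightarrow> real" where
  "omega_tilde n lam = omega_tilde_nodes n (young lam)"

text \<open>e-ladder number of a node.\<close>
definition ladder :: "nat \<Rightarrow> nat \<times> nat \<Rightarrow> nat" where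
  "ladder e p = fst p + (e - 1) * (snd p - 1)"

text \<open>e-regularization of a set of nodes: on every ladder, keep as many nodes as the
  original diagram has on that ladder, placed in the highest possible positions
  (smallest row indices) among all nodes (a,b), a,b >= 1, of that ladder.\<close>
definition reg_nodes :: "nat \<Rightarrow> (nat \<times> nat) set \<Rightarrow> (nat \<times> nat) set" where
  "reg_nodes e Y = {(a,b). 1 \<le> a \<and> 1 \<le> b \<and>
     card {(a',b'). 1 \<le> a' \<and> 1 \<le> b' \<and> ladder e (a',b') = ladder e (a,b) \<and> a' \<le> a}
       \<le> card {q\<in>Y. ladder e q = ladder e (a,b)}}"

text \<open>The graph region gr(g).\<close>
definition gr_a :: "(real \<Rightarrow> real) \<Rightarrow> real" where
  "gr_a g = Inf {x. g x \<noteq> \<bar>x\<bar>}"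
definition gr_b :: "(real \<Rightarrow> real) \<Rightarrow> real" where
  "gr_b g = Sup {x. g x \<noteq> \<bar>x\<bar>}"
definition gr :: "(real \<Rightarrow> real) \<Rightarrow> (real \<times> real) set" where
  "gr g = {(x,y). gr_a g \<le> x \<and> x \<le> gr_b g \<and> 0 \<le> y \<and> \<bar>x\<bar> \<le> y \<and> y \<le> g x}"

text \<open>Shaking in direction v_alpha onto the line D: y = -x.\<close>
definition v_dir :: "real \<Rightarrow> real \<times> real" where
  "v_dir \<alpha> = (1 / sqrt (1 + \<alpha>\<^sup>2)) *\<^sub>R (1, \<alpha>)"

definition Sh :: "real \<Rightarrow> (real \<times> real) set \<Rightarrow> (real \<times> real) set" where
  "Sh \<alpha> K = (\<Union>p\<in>{p. snd p = - fst p}.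
      (if K \<inter> {p + t *\<^sub>R v_dir \<alpha> | t. True} = {} then {}
       else closed_segment p (p + measure lebesgue {t. p + t *\<^sub>R v_dir \<alpha> \<in> K} *\<^sub>R v_dir \<alpha>)))"

definition sh :: "nat \<Rightarrow> (real \<times> real) set \<Rightarrow> (real \<times> real) set" where
  "sh e = Sh (1 - 2 / real e)"

end

theory Submission
  imports Defs
begin

text \<open>Regularization keeps the number of nodes on every e-ladder and places them in the
  largest columns of that ladder. It yields a diagram again because the number of positions
  missing from ladder L is at most that of ladder L + 1, and smaller than that of ladder
  L + (e - 1) unless the latter is zero. The region between a profile and the graph of the absolute
  value is the union of the node squares. The squares of one ladder are translates of each other
  along the shaking direction v_(1-2/e), and since this direction is not diagonal, the overlap
  of two distinct squares meets each shaking line in at most one point. Hence the length of every shaking line inside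
  the region depends only on the ladder counts, and so does the shaken region. The rescaled
  profiles follow by dilation, which commutes with taking regions and with shaking.\<close>

section \<open>Diagrams, ladders and e-regularization\<close>

definition down_closed :: "(nat \<times> nat) set \<Rightarrow> bool" where
  "down_closed Y \<longleftrightarrow> (\<forall>(a,b)\<in>Y. 1 \<le> a \<and> 1 \<le> b \<and>
     (\<forall>a' b'. 1 \<le> a' \<longrightarrow> a' \<le> a \<longrightarrow> 1 \<le> b' \<longrightarrow> b' \<le> b \<longrightarrow> (a',b') \<in> Y))"

definition ladder_nodes :: "nat \<Rightarrow> nat \<Rightarrow> (nat \<times> nat) set" where
  "ladder_nodes e L = {(a,b). 1 \<le> a \<and> 1 \<le> b \<and> ladder e (a,b) = L}"

definition ladder_count :: "nat \<Rightarrow> (nat \<times> nat) set \<Rightarrow> nat \<Rightarrow> nat" where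
  "ladder_count e Y L = card {q\<in>Y. ladder e q = L}"

definition ladder_gaps :: "nat \<Rightarrow> (nat \<times> nat) set \<Rightarrow> nat \<Rightarrow> nat" where
  "ladder_gaps e Y L = card (ladder_nodes e L - Y)"

lemma down_closedD:
  "down_closed Y \<Longrightarrow> (a,b) \<in> Y \<Longrightarrow> 1 \<le> a' \<Longrightarrow> a' \<le> a \<Longrightarrow> 1 \<le> b' \<Longrightarrow> b' \<le> b \<Longrightarrow> (a',b') \<in> Y"
  unfolding down_closed_def by blast

lemma down_closed_positive: "down_closed Y \<Longrightarrow> Y \<subseteq> {(a,b). 1 \<le> a \<and> 1 \<le> b}"
  unfolding down_closed_def by blast

lemma down_closedI:
  assumes pos: "Y \<subseteq> {(a,b). 1 \<le> a \<and> 1 \<le> b}"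
    and row: "\<And>a b. (Suc a, b) \<in> Y \<Longrightarrow> 1 \<le> a \<Longrightarrow> (a,b) \<in> Y"
    and col: "\<And>a b. (a, Suc b) \<in> Y \<Longrightarrow> 1 \<le> b \<Longrightarrow> (a,b) \<in> Y"
  shows "down_closed Y"
proof -
  have "(a',b') \<in> Y" if ab: "(a,b) \<in> Y" and "1 \<le> a'" "a' \<le> a" "1 \<le> b'" "b' \<le> b"
    for a b a' b'
  proof -
    from \<open>a' \<le> a\<close> have "(a',b) \<in> Y"
      by (induction a' rule: inc_induct) (use ab \<open>1 \<le> a'\<close> row in auto)
    with \<open>b' \<le> b\<close> show "(a',b') \<in> Y"
      by (induction b' rule: inc_induct) (use \<open>1 \<le> b'\<close> col in auto)
  qed
  with pos show ?thesis unfolding down_closed_def by blast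
qed

lemma ladder_Pair: "ladder e (a,b) = a + (e - 1) * (b - 1)"
  by (simp add: ladder_def)

lemma bij_betw_snd_ladder_nodes:
  assumes "e \<ge> 2"
  shows "bij_betw snd (ladder_nodes e L) {1..card (ladder_nodes e L)}"
proof -
  have inj: "inj_on snd (ladder_nodes e L)"
    by (auto intro!: inj_onI simp: ladder_nodes_def ladder_Pair)
  define m where "m = (if L = 0 then 0 else (L - 1) div (e - 1) + 1)"
  have "b \<in> snd ` ladder_nodes e L \<longleftrightarrow> 1 \<le> b \<and> (e - 1) * (b - 1) < L" for b
  proof
    assume "b \<in> snd ` ladder_nodes e L"
    then show "1 \<le> b \<and> (e - 1) * (b - 1) < L"
      by (auto simp: ladder_nodes_def ladder_Pair)
  next
    assume "1 \<le> b \<and> (e - 1) * (b - 1) < L"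
    then have "(L - (e - 1) * (b - 1), b) \<in> ladder_nodes e L"
      by (auto simp: ladder_nodes_def ladder_Pair)
    then show "b \<in> snd ` ladder_nodes e L" by force
  qed
  moreover have "1 \<le> b \<and> (e - 1) * (b - 1) < L \<longleftrightarrow> b \<in> {1..m}" for b
  proof (cases "L = 0")
    case False
    have "(e - 1) * (b - 1) < L \<longleftrightarrow> (b - 1) * (e - 1) \<le> L - 1"
      using False by (auto simp: mult.commute)
    also have "\<dots> \<longleftrightarrow> b - 1 \<le> (L - 1) div (e - 1)"
      using assms less_eq_div_iff_mult_less_eq[of "e - 1" "b - 1" "L - 1"] by simp
    finally have "(e - 1) * (b - 1) < L \<longleftrightarrow> b - 1 \<le> (L - 1) div (e - 1)" .
    then show ?thesis using False by (auto simp: m_def)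
  qed (simp add: m_def)
  ultimately have img: "snd ` ladder_nodes e L = {1..m}" by blast
  then have "card (ladder_nodes e L) = m"
    using card_image[OF inj] by simp
  with inj img show ?thesis by (simp add: bij_betw_def)
qed

lemma finite_ladder_nodes: "e \<ge> 2 \<Longrightarrow> finite (ladder_nodes e L)"
  using bij_betw_finite bij_betw_snd_ladder_nodes by blast

lemma card_ladder_nodes_column:
  assumes "e \<ge> 2"
  shows "card {q\<in>ladder_nodes e L. P (snd q)} = card {b\<in>{1..card (ladder_nodes e L)}. P b}"
proof -
  note bij = bij_betw_snd_ladder_nodes[OF assms, of L]
  have "snd ` {q\<in>ladder_nodes e L. P (snd q)} = {b\<in>snd ` ladder_nodes e L. P b}" by force
  also have "\<dots> = {b\<in>{1..card (ladder_nodes e L)}. P b}"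
    using bij by (simp add: bij_betw_def)
  finally have img: "snd ` {q\<in>ladder_nodes e L. P (snd q)} = {b\<in>{1..card (ladder_nodes e L)}. P b}" .
  have "inj_on snd {q\<in>ladder_nodes e L. P (snd q)}"
    using bij by (auto simp: bij_betw_def inj_on_def)
  from card_image[OF this] show ?thesis by (simp only: img)
qed

lemma ladder_row_le_iff:
  assumes "e \<ge> 2" "1 \<le> b" "1 \<le> b'" "ladder e (a',b') = ladder e (a,b)"
  shows "a' \<le> a \<longleftrightarrow> b \<le> b'"
proof -
  have "a' \<le> a \<longleftrightarrow> (e - 1) * (b - 1) \<le> (e - 1) * (b' - 1)"
    using assms(4) unfolding ladder_Pair by linarith
  also have "\<dots> \<longleftrightarrow> b - 1 \<le> b' - 1" using assms(1) by simp
  also have "\<dots> \<longleftrightarrow> b \<le> b'" using assms(2,3) by linarith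
  finally show ?thesis .
qed

lemma ladder_count_add_gaps:
  assumes "e \<ge> 2" and "Y \<subseteq> {(a,b). 1 \<le> a \<and> 1 \<le> b}"
  shows "ladder_count e Y L + ladder_gaps e Y L = card (ladder_nodes e L)"
proof -
  have "{q\<in>Y. ladder e q = L} = ladder_nodes e L \<inter> Y"
    using assms(2) by (auto simp: ladder_nodes_def)
  then show ?thesis
    using card_Int_Diff[OF finite_ladder_nodes[OF assms(1)]]
    by (simp add: ladder_count_def ladder_gaps_def)
qed

lemma reg_nodes_iff:
  assumes e: "e \<ge> 2" and pos: "Y \<subseteq> {(a,b). 1 \<le> a \<and> 1 \<le> b}"
  shows "(a,b) \<in> reg_nodes e Y \<longleftrightarrow> 1 \<le> a \<and> 1 \<le> b \<and> ladder_gaps e Y (ladder e (a,b)) < b"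
proof (cases "1 \<le> a \<and> 1 \<le> b")
  case True
  define L where "L = ladder e (a,b)"
  define N where "N = card (ladder_nodes e L)"
  have "(a,b) \<in> ladder_nodes e L" using True by (simp add: ladder_nodes_def L_def)
  then have "b \<in> snd ` ladder_nodes e L" by (rule rev_image_eqI) simp
  then have "b \<in> {1..N}"
    using bij_betw_snd_ladder_nodes[OF e, of L] by (simp add: N_def bij_betw_def)
  have "a' \<le> a \<longleftrightarrow> b \<le> b'" if "1 \<le> b'" "ladder e (a',b') = L" for a' b'
    using ladder_row_le_iff[OF e _ that(1)] True that(2) by (simp add: L_def)
  then have "{(a',b'). 1 \<le> a' \<and> 1 \<le> b' \<and> ladder e (a',b') = L \<and> a' \<le> a}
      = {q\<in>ladder_nodes e L. b \<le> snd q}"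
    by (auto simp: ladder_nodes_def)
  moreover have "{b'\<in>{1..N}. b \<le> b'} = {b..N}" using \<open>b \<in> {1..N}\<close> by auto
  ultimately have "card {(a',b'). 1 \<le> a' \<and> 1 \<le> b' \<and> ladder e (a',b') = L \<and> a' \<le> a} = N + 1 - b"
    using card_ladder_nodes_column[OF e, of L "\<lambda>b'. b \<le> b'"] by (simp add: N_def)
  moreover have "card {q\<in>Y. ladder e q = L} + ladder_gaps e Y L = N"
    using ladder_count_add_gaps[OF e pos] by (simp add: ladder_count_def N_def)
  ultimately show ?thesis
    using True \<open>b \<in> {1..N}\<close> by (auto simp: reg_nodes_def L_def)
qed (auto simp: reg_nodes_def)

lemma ladder_count_reg_nodes:
  assumes e: "e \<ge> 2" and pos: "Y \<subseteq> {(a,b). 1 \<le> a \<and> 1 \<le> b}"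
  shows "ladder_count e (reg_nodes e Y) L = ladder_count e Y L"
proof -
  define N where "N = card (ladder_nodes e L)"
  have "{q\<in>reg_nodes e Y. ladder e q = L} = {q\<in>ladder_nodes e L. ladder_gaps e Y L < snd q}"
    by (auto simp: reg_nodes_iff[OF e pos] ladder_nodes_def)
  moreover have "{b\<in>{1..N}. ladder_gaps e Y L < b} = {Suc (ladder_gaps e Y L)..N}" by auto
  ultimately have "ladder_count e (reg_nodes e Y) L = N - ladder_gaps e Y L"
    using card_ladder_nodes_column[OF e, of L "\<lambda>b. ladder_gaps e Y L < b"]
    by (simp add: ladder_count_def N_def)
  also have "\<dots> = ladder_count e Y L"
    using ladder_count_add_gaps[OF e pos, of L] by (simp add: N_def)
  finally show ?thesis .
qed

lemma ladder_gaps_le_Suc: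
  assumes e: "e \<ge> 2" and Y: "down_closed Y"
  shows "ladder_gaps e Y L \<le> ladder_gaps e Y (Suc L)"
  unfolding ladder_gaps_def
proof (rule card_inj_on_le)
  show "inj_on (\<lambda>(a,b). (Suc a, b)) (ladder_nodes e L - Y)"
    by (auto intro: inj_onI)
  show "(\<lambda>(a,b). (Suc a, b)) ` (ladder_nodes e L - Y) \<subseteq> ladder_nodes e (Suc L) - Y"
    using down_closedD[OF Y] by (force simp: ladder_nodes_def ladder_Pair)
qed (use finite_ladder_nodes[OF e] in blast)

text \<open>The missing nodes of ladder L left of column t move one row down, the others one column
  to the right; by down-closure the images are missing nodes of ladder L + (e - 1).\<close>
lemma ladder_gaps_le_gaps_off_column:
  assumes e: "e \<ge> 2" and Y: "down_closed Y"
  shows "ladder_gaps e Y L \<le> card {q \<in> ladder_nodes e (L + (e - 1)) - Y. snd q \<noteq> t}"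
  unfolding ladder_gaps_def
proof (rule card_inj_on_le)
  define f where "f = (\<lambda>(a,b). if b < t then (a + (e - 1), b) else (a, Suc b))"
  show "inj_on f (ladder_nodes e L - Y)"
    by (auto simp: inj_on_def f_def split: if_splits)
  show "f ` (ladder_nodes e L - Y) \<subseteq> {q \<in> ladder_nodes e (L + (e - 1)) - Y. snd q \<noteq> t}"
  proof (rule image_subsetI)
    fix q assume "q \<in> ladder_nodes e L - Y"
    then obtain a b where q: "q = (a,b)" and ab: "(a,b) \<in> ladder_nodes e L" "(a,b) \<notin> Y"
      by (cases q) auto
    then have "1 \<le> a" "1 \<le> b" "a + (e - 1) * (b - 1) = L"
      by (auto simp: ladder_nodes_def ladder_Pair)
    have "(e - 1) * b = (e - 1) * (b - 1) + (e - 1)"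
      using \<open>1 \<le> b\<close> by (cases b) auto
    show "f q \<in> {q \<in> ladder_nodes e (L + (e - 1)) - Y. snd q \<noteq> t}"
    proof (cases "b < t")
      case True
      have "(a + (e - 1), b) \<notin> Y"
        using ab(2) down_closedD[OF Y, of "a + (e - 1)" b a b] \<open>1 \<le> a\<close> \<open>1 \<le> b\<close> by auto
      with True show ?thesis
        using \<open>a + (e - 1) * (b - 1) = L\<close> \<open>1 \<le> a\<close> \<open>1 \<le> b\<close>
        by (simp add: q f_def ladder_nodes_def ladder_Pair)
    next
      case False
      have "(a, Suc b) \<notin> Y"
        using ab(2) down_closedD[OF Y, of a "Suc b" a b] \<open>1 \<le> a\<close> \<open>1 \<le> b\<close> by auto
      with False show ?thesis
        using \<open>a + (e - 1) * (b - 1) = L\<close> \<open>(e - 1) * b = (e - 1) * (b - 1) + (e - 1)\<close> \<open>1 \<le> a\<close>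
        by (simp add: q f_def ladder_nodes_def ladder_Pair)
    qed
  qed
qed (simp add: finite_ladder_nodes[OF e])

lemma ladder_gaps_le_next_column:
  assumes e: "e \<ge> 2" and Y: "down_closed Y"
  shows "ladder_gaps e Y L \<le> ladder_gaps e Y (L + (e - 1)) - 1"
proof -
  define G where "G = ladder_nodes e (L + (e - 1)) - Y"
  note shift = ladder_gaps_le_gaps_off_column[OF e Y, of L, folded G_def]
  show ?thesis
  proof (cases "G = {}")
    case True
    then show ?thesis using shift[of 0] by (simp add: ladder_gaps_def)
  next
    case False
    then obtain r t where "(r,t) \<in> G" by auto
    have "card {q\<in>G. snd q \<noteq> t} \<le> card (G - {(r,t)})"
      by (rule card_mono) (auto simp: G_def finite_ladder_nodes[OF e])
    also have "\<dots> = card G - 1"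
      using \<open>(r,t) \<in> G\<close> by (simp add: card_Diff_singleton)
    finally show ?thesis using shift[of t] by (simp add: ladder_gaps_def G_def)
  qed
qed

lemma down_closed_reg_nodes:
  assumes e: "e \<ge> 2" and Y: "down_closed Y"
  shows "down_closed (reg_nodes e Y)"
proof (rule down_closedI)
  note reg = reg_nodes_iff[OF e down_closed_positive[OF Y]]
  show "reg_nodes e Y \<subseteq> {(a,b). 1 \<le> a \<and> 1 \<le> b}" by (auto simp: reg_nodes_def)
  fix a b
  show "(a,b) \<in> reg_nodes e Y" if "(Suc a, b) \<in> reg_nodes e Y" "1 \<le> a"
    using that ladder_gaps_le_Suc[OF e Y, of "ladder e (a,b)"] by (simp add: reg ladder_Pair)
  show "(a,b) \<in> reg_nodes e Y" if "(a, Suc b) \<in> reg_nodes e Y" "1 \<le> b"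
  proof -
    have "ladder e (a, Suc b) = ladder e (a,b) + (e - 1)"
      using that(2) by (cases b) (auto simp: ladder_Pair)
    then show ?thesis
      using that ladder_gaps_le_next_column[OF e Y, of "ladder e (a,b)"] by (simp add: reg, linarith)
  qed
qed

lemma ladder_count_pos_iff:
  "finite Y \<Longrightarrow> 0 < ladder_count e Y L \<longleftrightarrow> (\<exists>q\<in>Y. ladder e q = L)"
  by (auto simp: ladder_count_def card_gt_0_iff)

lemma ladder_image_eq: "finite Y \<Longrightarrow> ladder e ` Y = {L. 0 < ladder_count e Y L}"
  by (auto simp: ladder_count_pos_iff)

lemma finite_reg_nodes:
  assumes e: "e \<ge> 2" and Y: "down_closed Y" "finite Y"
  shows "finite (reg_nodes e Y)"
proof (rule finite_subset)
  show "reg_nodes e Y \<subseteq> (\<Union>q\<in>Y. ladder_nodes e (ladder e q))"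
  proof
    fix p assume p: "p \<in> reg_nodes e Y"
    have "finite {q\<in>reg_nodes e Y. ladder e q = ladder e p}"
      by (rule finite_subset[OF _ finite_ladder_nodes[OF e]]) (auto simp: reg_nodes_def ladder_nodes_def)
    then have "0 < ladder_count e (reg_nodes e Y) (ladder e p)"
      unfolding ladder_count_def card_gt_0_iff using p by blast
    then obtain q where "q \<in> Y" "ladder e q = ladder e p"
      using ladder_count_reg_nodes[OF e down_closed_positive[OF Y(1)]] ladder_count_pos_iff[OF Y(2)]
      by metis
    moreover have "p \<in> ladder_nodes e (ladder e p)"
      using p by (auto simp: reg_nodes_def ladder_nodes_def)
    ultimately show "p \<in> (\<Union>q\<in>Y. ladder_nodes e (ladder e q))"
      by (metis UN_I)
  qed
qed (use Y(2) finite_ladder_nodes[OF e] in blast)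

lemma reg_nodes_nonempty:
  assumes e: "e \<ge> 2" and Y: "down_closed Y" "finite Y" "Y \<noteq> {}"
  shows "reg_nodes e Y \<noteq> {}"
proof -
  obtain q where "q \<in> Y" using Y(3) by blast
  then have "0 < ladder_count e (reg_nodes e Y) (ladder e q)"
    using ladder_count_reg_nodes[OF e down_closed_positive[OF Y(1)]] ladder_count_pos_iff[OF Y(2)]
    by metis
  then show ?thesis by (auto simp: ladder_count_def)
qed

lemma down_closed_young:
  assumes "is_partition lam n"
  shows "down_closed (young lam)"
proof (rule down_closedI)
  have sorted: "sorted_wrt (\<ge>) lam" using assms by (simp add: is_partition_def)
  show "(a,b) \<in> young lam" if "(Suc a, b) \<in> young lam" "1 \<le> a" for a b
  proof -
    from that have "a < length lam" "1 \<le> b" "b \<le> lam ! a" by (auto simp: young_def)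
    moreover have "lam ! a \<le> lam ! (a - 1)"
      using sorted_wrt_nth_less[OF sorted, of "a - 1" a] \<open>a < length lam\<close> \<open>1 \<le> a\<close> by simp
    ultimately show ?thesis using \<open>1 \<le> a\<close> by (simp add: young_def)
  qed
qed (auto simp: young_def)

lemma finite_young: "finite (young lam)"
proof (rule finite_subset)
  have "b \<le> sum_list lam" if "(a,b) \<in> young lam" for a b
  proof -
    from that have "a - 1 < length lam" "b \<le> lam ! (a - 1)" by (auto simp: young_def)
    then show ?thesis using elem_le_sum_list[of "a - 1" lam] by simp
  qed
  then show "young lam \<subseteq> {..length lam} \<times> {..sum_list lam}"
    by (auto simp: young_def)
qed simp

lemma young_nonempty:
  assumes "is_partition lam n" "lam \<noteq> []"
  shows "young lam \<noteq> {}"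
proof -
  have "0 < lam ! 0" using assms by (simp add: is_partition_def)
  then have "(1,1) \<in> young lam" using assms(2) by (simp add: young_def Suc_le_eq)
  then show ?thesis by blast
qed

lemma partition_size_pos:
  assumes "is_partition lam n" "lam \<noteq> []"
  shows "0 < n"
proof -
  have "0 < lam ! 0" "lam ! 0 \<le> n"
    using assms elem_le_sum_list[of 0 lam] by (auto simp: is_partition_def)
  then show ?thesis by linarith
qed

section \<open>Regions under profiles\<close>

definition line_section :: "'a::real_vector \<Rightarrow> 'a \<Rightarrow> 'a set \<Rightarrow> real set" where
  "line_section p v K = {t. p + t *\<^sub>R v \<in> K}"

lemma compact_line_section:
  fixes v :: "'a::real_normed_vector"
  assumes "compact K" "v \<noteq> 0"
  shows "compact (line_section p v K)"
proof -
  have "closed ((\<lambda>t::real. p + t *\<^sub>R v) -` K)"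
    by (intro continuous_closed_vimage compact_imp_closed[OF assms(1)] continuous_intros)
  then have "closed (line_section p v K)" by (simp add: vimage_def line_section_def)
  moreover obtain B where B: "\<And>z. z \<in> K \<Longrightarrow> norm z \<le> B"
    using compact_imp_bounded[OF assms(1)] by (auto simp: bounded_iff)
  have "\<bar>t\<bar> \<le> (B + norm p) / norm v" if "p + t *\<^sub>R v \<in> K" for t
  proof -
    have "\<bar>t\<bar> * norm v \<le> norm (p + t *\<^sub>R v) + norm p"
      using norm_triangle_ineq4[of "p + t *\<^sub>R v" p] by simp
    also have "\<dots> \<le> B + norm p" using B[OF that] by simp
    finally show ?thesis using assms(2) by (simp add: pos_le_divide_eq)
  qed
  then have "bounded (line_section p v K)"
    by (auto simp: bounded_iff line_section_def)
  ultimately show ?thesis by (simp add: compact_eq_bounded_closed)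
qed

lemma node_square_iff:
  "(x,y) \<in> node_square (a,b) \<longleftrightarrow>
     2 * real a - 2 \<le> x + y \<and> x + y \<le> 2 * real a \<and> 2 * real b - 2 \<le> y - x \<and> y - x \<le> 2 * real b"
  unfolding node_square_def by (auto simp: abs_if)

lemma compact_node_square: "compact (node_square q)"
proof -
  obtain a b where q: "q = (a,b)" by fastforce
  have "closed (node_square q)"
    unfolding q node_square_def case_prod_unfold
    by (intro closed_Collect_le continuous_intros)
  moreover have "node_square q \<subseteq> cbox (real a - real b - 1, real a + real b - 2) (real a - real b + 1, real a + real b)"
    by (auto simp: q node_square_def cbox_Pair_eq abs_le_iff)
  then have "bounded (node_square q)" by (rule bounded_subset[OF bounded_cbox])
  ultimately show ?thesis by (simp add: compact_eq_bounded_closed)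
qed

lemma node_square_above_abs:
  "(x,y) \<in> node_square (a,b) \<Longrightarrow> 1 \<le> a \<Longrightarrow> 1 \<le> b \<Longrightarrow> \<bar>x\<bar> \<le> y"
  by (auto simp: node_square_iff abs_if)

lemma compact_vertical_slice:
  assumes "finite Y"
  shows "compact {y. \<exists>q\<in>Y. (x,y) \<in> node_square q}"
proof -
  have "compact {y. (x,y) \<in> node_square q}" for q
    using compact_line_section[OF compact_node_square, of "(0::real, 1::real)" "(x,0)" q]
    by (simp add: line_section_def zero_prod_def)
  moreover have "{y. \<exists>q\<in>Y. (x,y) \<in> node_square q} = (\<Union>q\<in>Y. {y. (x,y) \<in> node_square q})"
    by auto
  ultimately show ?thesis using assms by (auto intro: compact_UN)
qed

lemma omega_nodes_ge:
  assumes "finite Y" "q \<in> Y" "(x,y) \<in> node_square q"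
  shows "y \<le> omega_nodes Y x"
proof -
  have "y \<in> {y. \<exists>q\<in>Y. (x,y) \<in> node_square q}" using assms by auto
  moreover have "bdd_above {y. \<exists>q\<in>Y. (x,y) \<in> node_square q}"
    using compact_vertical_slice[OF assms(1)] by (intro bounded_imp_bdd_above compact_imp_bounded)
  ultimately show ?thesis
    by (auto simp: omega_nodes_def Let_def intro: cSup_upper le_max_iff_disj[THEN iffD2])
qed

lemma omega_nodes_attained:
  assumes "finite Y" "omega_nodes Y x \<noteq> \<bar>x\<bar>"
  obtains a b where "(a,b) \<in> Y" "(x, omega_nodes Y x) \<in> node_square (a,b)"
proof -
  define S where "S = {y. \<exists>q\<in>Y. (x,y) \<in> node_square q}"
  have "S \<noteq> {}" "omega_nodes Y x = Sup S"
    using assms(2) by (auto simp: omega_nodes_def S_def Let_def max_def split: if_splits)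
  moreover have "Sup S \<in> S"
    using compact_vertical_slice[OF assms(1), of x, folded S_def] \<open>S \<noteq> {}\<close>
    by (intro closed_contains_Sup bounded_imp_bdd_above compact_imp_bounded compact_imp_closed)
  ultimately show ?thesis using that by (auto simp: S_def)
qed

lemma omega_nodes_neq_abs:
  assumes "finite Y" "(a,b) \<in> Y" "1 \<le> a" "1 \<le> b" "\<bar>x - (real a - real b)\<bar> < 1"
  shows "omega_nodes Y x \<noteq> \<bar>x\<bar>"
proof -
  define y where "y = real a + real b - \<bar>x - (real a - real b)\<bar>"
  have "(x,y) \<in> node_square (a,b)" using assms(5) by (auto simp: node_square_def y_def)
  then have "y \<le> omega_nodes Y x" by (rule omega_nodes_ge[OF assms(1,2)])
  moreover have "\<bar>x\<bar> < y" using assms(3-5) by (auto simp: y_def abs_if)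
  ultimately show ?thesis by simp
qed

lemma nat_cell_containing:
  assumes "0 \<le> u" "u \<le> real a" "1 \<le> a"
  obtains k :: nat where "1 \<le> k" "k \<le> a" "real k - 1 \<le> u" "u \<le> real k"
proof (cases "u \<le> 1")
  case True
  then show ?thesis using assms that[of 1] by auto
next
  case False
  have "real (nat \<lceil>u\<rceil>) = of_int \<lceil>u\<rceil>" using False by simp
  moreover have "\<lceil>u\<rceil> \<le> int a" using assms(2) by (simp add: ceiling_le_iff)
  ultimately show ?thesis
    using False that[of "nat \<lceil>u\<rceil>"] by linarith
qed

text \<open>In the coordinates x + y and y - x, the square of node (k,l) is the cell
  [2k - 2, 2k] \<times> [2l - 2, 2l].\<close>
lemma down_closed_covers_rectangle:
  assumes Y: "down_closed Y" and ab: "(a,b) \<in> Y"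
    and "0 \<le> x + y" "x + y \<le> 2 * real a" "0 \<le> y - x" "y - x \<le> 2 * real b"
  shows "\<exists>q\<in>Y. (x,y) \<in> node_square q"
proof -
  have "1 \<le> a" "1 \<le> b" using down_closed_positive[OF Y] ab by auto
  obtain k where k: "1 \<le> k" "k \<le> a" "real k - 1 \<le> (x + y) / 2" "(x + y) / 2 \<le> real k"
    using nat_cell_containing[of "(x + y) / 2" a] assms \<open>1 \<le> a\<close> by auto
  obtain l where l: "1 \<le> l" "l \<le> b" "real l - 1 \<le> (y - x) / 2" "(y - x) / 2 \<le> real l"
    using nat_cell_containing[of "(y - x) / 2" b] assms \<open>1 \<le> b\<close> by auto
  have "(k,l) \<in> Y" using down_closedD[OF Y ab k(1,2) l(1,2)] .
  moreover have "(x,y) \<in> node_square (k,l)" using k l by (simp add: node_square_iff)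
  ultimately show ?thesis by blast
qed

lemma Inf_Sup_eq_endpoints:
  fixes U :: "real set"
  assumes "a < a'" "b' < b" "{a<..<a'} \<subseteq> U" "{b'<..<b} \<subseteq> U" "U \<subseteq> {a..b}"
  shows "Inf U = a" "Sup U = b"
proof -
  have "U \<noteq> {}" using assms(1,3) by (auto dest: dense)
  have "bdd_below U" by (rule bdd_belowI[of _ a]) (use assms(5) in auto)
  have "bdd_above U" by (rule bdd_aboveI[of _ b]) (use assms(5) in auto)
  show "Inf U = a"
  proof (rule antisym)
    show "Inf U \<le> a"
      using cInf_superset_mono[OF _ \<open>bdd_below U\<close> assms(3)] assms(1) by simp
    show "a \<le> Inf U" using \<open>U \<noteq> {}\<close> assms(5) by (intro cInf_greatest) auto
  qed
  show "Sup U = b"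
  proof (rule antisym)
    show "b \<le> Sup U"
      using cSup_subset_mono[OF _ \<open>bdd_above U\<close> assms(4)] assms(2) by simp
    show "Sup U \<le> b" using \<open>U \<noteq> {}\<close> assms(5) by (intro cSup_least) auto
  qed
qed

lemma le_Max_nodes:
  assumes "finite Y" "(a,b) \<in> Y"
  shows "a \<le> Max (fst ` Y)" "b \<le> Max (snd ` Y)"
  using assms by (force intro: Max_ge)+

lemma down_closed_extreme_nodes:
  assumes Y: "down_closed Y" "finite Y" "Y \<noteq> {}"
  shows "(Max (fst ` Y), 1) \<in> Y" "(1, Max (snd ` Y)) \<in> Y"
proof -
  have "Max (fst ` Y) \<in> fst ` Y" "Max (snd ` Y) \<in> snd ` Y" using Y(2,3) by simp_all
  then obtain a b a' b' where "(a,b) \<in> Y" "a = Max (fst ` Y)" "(a',b') \<in> Y" "b' = Max (snd ` Y)"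
    by force
  moreover have "1 \<le> a" "1 \<le> b" "1 \<le> a'" "1 \<le> b'"
    using calculation down_closed_positive[OF Y(1)] by auto
  ultimately show "(Max (fst ` Y), 1) \<in> Y" "(1, Max (snd ` Y)) \<in> Y"
    using down_closedD[OF Y(1)] by auto
qed

lemma omega_nodes_support:
  assumes Y: "down_closed Y" "finite Y" "Y \<noteq> {}"
  defines "A \<equiv> real (Max (fst ` Y))" and "B \<equiv> real (Max (snd ` Y))"
  shows "{- B<..<2 - B} \<subseteq> {x. omega_nodes Y x \<noteq> \<bar>x\<bar>}"
    and "{A - 2<..<A} \<subseteq> {x. omega_nodes Y x \<noteq> \<bar>x\<bar>}"
    and "{x. omega_nodes Y x \<noteq> \<bar>x\<bar>} \<subseteq> {- B..A}"
proof -
  have le: "real a \<le> A" "real b \<le> B" if "(a,b) \<in> Y" for a b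
    using le_Max_nodes[OF Y(2) that] by (simp_all add: A_def B_def)
  note extreme = down_closed_extreme_nodes[OF Y]
  have "1 \<le> Max (fst ` Y)" "1 \<le> Max (snd ` Y)"
    using extreme down_closed_positive[OF Y(1)] by auto
  show "{- B<..<2 - B} \<subseteq> {x. omega_nodes Y x \<noteq> \<bar>x\<bar>}"
    using omega_nodes_neq_abs[OF Y(2) extreme(2)] \<open>1 \<le> Max (snd ` Y)\<close>
    by (auto simp: B_def abs_less_iff)
  show "{A - 2<..<A} \<subseteq> {x. omega_nodes Y x \<noteq> \<bar>x\<bar>}"
    using omega_nodes_neq_abs[OF Y(2) extreme(1)] \<open>1 \<le> Max (fst ` Y)\<close>
    by (auto simp: A_def abs_less_iff)
  show "{x. omega_nodes Y x \<noteq> \<bar>x\<bar>} \<subseteq> {- B..A}"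
  proof
    fix x assume "x \<in> {x. omega_nodes Y x \<noteq> \<bar>x\<bar>}"
    then obtain a b where "(a,b) \<in> Y" "(x, omega_nodes Y x) \<in> node_square (a,b)"
      using omega_nodes_attained[OF Y(2)] by blast
    then show "x \<in> {- B..A}"
      using le down_closed_positive[OF Y(1)] by (force simp: node_square_iff)
  qed
qed

lemma gr_omega_nodes:
  assumes Y: "down_closed Y" "finite Y" "Y \<noteq> {}"
  shows "gr (omega_nodes Y) = (\<Union>q\<in>Y. node_square q)"
proof -
  define A where "A = real (Max (fst ` Y))"
  define B where "B = real (Max (snd ` Y))"
  have "1 \<le> A" "1 \<le> B"
    using le_Max_nodes[OF Y(2)] down_closed_extreme_nodes[OF Y] by (force simp: A_def B_def)+
  note support = omega_nodes_support[OF Y, folded A_def B_def]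
  have ends: "gr_a (omega_nodes Y) = - B" "gr_b (omega_nodes Y) = A"
    using Inf_Sup_eq_endpoints[OF _ _ support] \<open>1 \<le> A\<close> \<open>1 \<le> B\<close>
    by (simp_all add: gr_a_def gr_b_def)
  have le: "real a \<le> A" "real b \<le> B" if "(a,b) \<in> Y" for a b
    using le_Max_nodes[OF Y(2) that] by (simp_all add: A_def B_def)
  note extreme = down_closed_extreme_nodes[OF Y]
  show ?thesis
  proof (intro set_eqI iffI)
    fix z assume "z \<in> gr (omega_nodes Y)"
    then obtain x y where z: "z = (x,y)" and x: "- B \<le> x" "x \<le> A"
      and y: "\<bar>x\<bar> \<le> y" "y \<le> omega_nodes Y x"
      by (auto simp: gr_def ends)
    have "\<exists>q\<in>Y. (x,y) \<in> node_square q"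
    proof (cases "omega_nodes Y x = \<bar>x\<bar>")
      case True
      then have "y = \<bar>x\<bar>" using y by simp
      show ?thesis
      proof (cases "0 \<le> x")
        case True
        then show ?thesis using down_closed_covers_rectangle[OF Y(1) extreme(1)]
          \<open>y = \<bar>x\<bar>\<close> x by (simp add: A_def)
      next
        case False
        then show ?thesis using down_closed_covers_rectangle[OF Y(1) extreme(2)]
          \<open>y = \<bar>x\<bar>\<close> x by (simp add: B_def)
      qed
    next
      case False
      then obtain a b where "(a,b) \<in> Y" "(x, omega_nodes Y x) \<in> node_square (a,b)"
        using omega_nodes_attained[OF Y(2)] by blast
      then show ?thesis
        using down_closed_covers_rectangle[OF Y(1), of a b x y] y by (auto simp: node_square_iff)
    qed
    then show "z \<in> (\<Union>q\<in>Y. node_square q)" using z by blast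
  next
    fix z assume "z \<in> (\<Union>q\<in>Y. node_square q)"
    then obtain a b x y where z: "z = (x,y)" and ab: "(a,b) \<in> Y" and sq: "(x,y) \<in> node_square (a,b)"
      by (metis UN_E surj_pair)
    have "1 \<le> a" "1 \<le> b" using ab down_closed_positive[OF Y(1)] by auto
    then have "\<bar>x\<bar> \<le> y" using node_square_above_abs[OF sq] by simp
    moreover have "- B \<le> x" "x \<le> A" using sq le[OF ab] \<open>1 \<le> a\<close> \<open>1 \<le> b\<close>
      by (auto simp: node_square_iff)
    moreover have "y \<le> omega_nodes Y x" by (rule omega_nodes_ge[OF Y(2) ab sq])
    ultimately show "z \<in> gr (omega_nodes Y)" using z by (auto simp: gr_def ends)
  qed
qed

section \<open>Shaking and dilations\<close>

lemma gr_dilate: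
  fixes g :: "real \<Rightarrow> real"
  assumes c: "0 < c" and U: "bounded {x. g x \<noteq> \<bar>x\<bar>}" "{x. g x \<noteq> \<bar>x\<bar>} \<noteq> {}"
  shows "gr (\<lambda>x. c * g (x / c)) = (*\<^sub>R) c ` gr g"
proof -
  define U where "U = {x. g x \<noteq> \<bar>x\<bar>}"
  have "{x. c * g (x / c) \<noteq> \<bar>x\<bar>} = (*) c ` U"
  proof (intro set_eqI iffI)
    fix x assume "x \<in> {x. c * g (x / c) \<noteq> \<bar>x\<bar>}"
    then have "x / c \<in> U" using c by (auto simp: U_def abs_div field_simps)
    then show "x \<in> (*) c ` U" using c by (intro image_eqI[of _ _ "x / c"]) auto
  qed (use c in \<open>auto simp: U_def abs_mult\<close>)
  moreover have "Inf ((*) c ` U) = c * Inf U" "Sup ((*) c ` U) = c * Sup U"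
    using U c bounded_imp_bdd_below bounded_imp_bdd_above
    by (auto simp: U_def mono_def intro!: continuous_at_Inf_mono[symmetric] continuous_at_Sup_mono[symmetric]
        continuous_intros)
  ultimately have ends: "gr_a (\<lambda>x. c * g (x / c)) = c * gr_a g" "gr_b (\<lambda>x. c * g (x / c)) = c * gr_b g"
    by (simp_all add: gr_a_def gr_b_def U_def)
  show ?thesis
  proof (intro set_eqI iffI)
    fix z assume "z \<in> gr (\<lambda>x. c * g (x / c))"
    then obtain x y where "z = (x,y)" "(x / c, y / c) \<in> gr g"
      using c by (auto simp: gr_def ends abs_div field_simps)
    then show "z \<in> (*\<^sub>R) c ` gr g"
      using c by (intro image_eqI[of _ _ "(x / c, y / c)"]) auto
  next
    fix z assume "z \<in> (*\<^sub>R) c ` gr g"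
    then show "z \<in> gr (\<lambda>x. c * g (x / c))"
      using c by (auto simp: gr_def ends abs_mult)
  qed
qed

lemma gr_dilate_omega_nodes:
  assumes Y: "down_closed Y" "finite Y" "Y \<noteq> {}" and c: "0 < c"
  shows "gr (\<lambda>x. c * omega_nodes Y (x / c)) = (*\<^sub>R) c ` gr (omega_nodes Y)"
proof (rule gr_dilate[OF c])
  note support = omega_nodes_support[OF Y]
  show "bounded {x. omega_nodes Y x \<noteq> \<bar>x\<bar>}"
    by (rule bounded_subset[OF bounded_closed_interval support(3)])
  have "1 - real (Max (snd ` Y)) \<in> {x. omega_nodes Y x \<noteq> \<bar>x\<bar>}"
    by (rule subsetD[OF support(1)]) simp
  then show "{x. omega_nodes Y x \<noteq> \<bar>x\<bar>} \<noteq> {}" by blast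
qed

lemma Sh_eq_line_sections:
  "Sh \<alpha> K = (\<Union>p\<in>{p. snd p = - fst p}.
      if line_section p (v_dir \<alpha>) K = {} then {}
      else closed_segment p (p + measure lebesgue (line_section p (v_dir \<alpha>) K) *\<^sub>R v_dir \<alpha>))"
proof -
  have "K \<inter> {p + t *\<^sub>R v_dir \<alpha> | t. True} = {} \<longleftrightarrow> line_section p (v_dir \<alpha>) K = {}" for p
    by (auto simp: line_section_def)
  then show ?thesis by (simp add: Sh_def line_section_def)
qed

lemma Sh_cong:
  assumes "\<And>p. line_section p (v_dir \<alpha>) K = {} \<longleftrightarrow> line_section p (v_dir \<alpha>) K' = {}"
    and "\<And>p. measure lebesgue (line_section p (v_dir \<alpha>) K) = measure lebesgue (line_section p (v_dir \<alpha>) K')"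
  shows "Sh \<alpha> K = Sh \<alpha> K'"
  unfolding Sh_eq_line_sections assms ..

lemma line_section_dilate:
  assumes "c \<noteq> 0"
  shows "line_section (c *\<^sub>R p) v ((*\<^sub>R) c ` K) = (*) c ` line_section p v K"
proof (intro set_eqI iffI)
  fix t assume "t \<in> line_section (c *\<^sub>R p) v ((*\<^sub>R) c ` K)"
  then obtain k where "k \<in> K" "c *\<^sub>R p + t *\<^sub>R v = c *\<^sub>R k" by (auto simp: line_section_def)
  then have "k = inverse c *\<^sub>R (c *\<^sub>R p + t *\<^sub>R v)" using assms by simp
  also have "\<dots> = p + (t / c) *\<^sub>R v" using assms by (simp add: scaleR_add_right divide_inverse_commute)
  finally have "p + (t / c) *\<^sub>R v \<in> K" using \<open>k \<in> K\<close> by simp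
  then show "t \<in> (*) c ` line_section p v K"
    using assms by (intro image_eqI[of _ _ "t / c"]) (auto simp: line_section_def)
next
  fix t assume "t \<in> (*) c ` line_section p v K"
  then obtain s where "t = c * s" "p + s *\<^sub>R v \<in> K" by (auto simp: line_section_def)
  moreover have "c *\<^sub>R p + (c * s) *\<^sub>R v = c *\<^sub>R (p + s *\<^sub>R v)" by (simp add: scaleR_add_right)
  ultimately show "t \<in> line_section (c *\<^sub>R p) v ((*\<^sub>R) c ` K)"
    by (auto simp: line_section_def)
qed

lemma Sh_dilate:
  assumes c: "0 < c"
  shows "Sh \<alpha> ((*\<^sub>R) c ` K) = (*\<^sub>R) c ` Sh \<alpha> K"
proof -
  define D :: "(real \<times> real) set" where "D = {p. snd p = - fst p}"
  define F where "F K' p = (if line_section p (v_dir \<alpha>) K' = {} then {}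
      else closed_segment p (p + measure lebesgue (line_section p (v_dir \<alpha>) K') *\<^sub>R v_dir \<alpha>))"
    for K' and p :: "real \<times> real"
  have D: "D = (*\<^sub>R) c ` D"
    using c by (auto simp: D_def image_iff intro!: exI[of _ "(1 / c) *\<^sub>R _"])
  have "F ((*\<^sub>R) c ` K) (c *\<^sub>R p) = (*\<^sub>R) c ` F K p" for p
  proof -
    have "measure lebesgue ((*) c ` S) = c * measure lebesgue S" for S :: "real set"
      using measure_lebesgue_affine[of c 0 S] c by simp
    moreover have "closed_segment (c *\<^sub>R p) (c *\<^sub>R p + (c * m) *\<^sub>R w)
        = (*\<^sub>R) c ` closed_segment p (p + m *\<^sub>R w)" for m w
      using closed_segment_linear_image[OF linear_scaleR, of c p "p + m *\<^sub>R w"]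
      by (simp add: scaleR_add_right)
    ultimately show ?thesis
      using c by (simp add: F_def line_section_dilate)
  qed
  then have "Sh \<alpha> ((*\<^sub>R) c ` K) = (\<Union>p\<in>D. (*\<^sub>R) c ` F K p)"
    unfolding Sh_eq_line_sections F_def[symmetric] D_def[symmetric] by (subst D) (simp add: image_image)
  then show ?thesis
    unfolding Sh_eq_line_sections F_def[symmetric] D_def[symmetric] by (simp add: image_UN)
qed

section \<open>Shaking unions of node squares\<close>

lemma mem_translation_image_iff: "(x::'a::ab_group_add) \<in> (+) d ` A \<longleftrightarrow> x - d \<in> A"
proof
  assume "x - d \<in> A"
  then show "x \<in> (+) d ` A" by (rule rev_image_eqI) simp
qed auto

lemma line_section_translate:
  "line_section p v ((+) (\<mu> *\<^sub>R v) ` K) = (+) \<mu> ` line_section p v K"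
  unfolding set_eq_iff mem_translation_image_iff line_section_def mem_Collect_eq
  by (simp add: algebra_simps)

lemma line_section_hyperplane:
  assumes "inner w v \<noteq> 0"
  shows "line_section p v {z. inner w z = k} = {(k - inner w p) / inner w v}"
  using assms by (auto simp: line_section_def inner_add_right field_simps)

lemma node_square_translate:
  "node_square (a',b') = (+) (real a' - real b' - (real a - real b), real a' + real b' - (real a + real b))
     ` node_square (a,b)"
  unfolding set_eq_iff mem_translation_image_iff node_square_def
  by (simp add: algebra_simps)

text \<open>One step along a ladder, from (a,b) to (a + e - 1, b - 1), moves the centre of the
  square by (e, e - 2), which is parallel to (1, 1 - 2/e).\<close>
lemma node_square_ladder_translate:
  assumes e: "e \<ge> 2" and "1 \<le> b" "1 \<le> b'" and lad: "ladder e (a,b) = ladder e (a',b')"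
  obtains \<mu> where "node_square (a',b') = (+) (\<mu> *\<^sub>R v_dir (1 - 2 / real e)) ` node_square (a,b)"
proof -
  define \<alpha> where "\<alpha> = 1 - 2 / real e"
  define s where "s = sqrt (1 + \<alpha>\<^sup>2)"
  define \<delta> where "\<delta> = real b' - real b"
  have "s > 0" by (simp add: s_def add_pos_nonneg)
  have "real (ladder e (a,b)) = real (ladder e (a',b'))" using lad by simp
  then have "real a + (real e - 1) * (real b - 1) = real a' + (real e - 1) * (real b' - 1)"
    using e assms(2,3) by (simp add: ladder_Pair of_nat_diff)
  then have "real a' - real a = - (real e - 1) * \<delta>"
    by (simp add: \<delta>_def algebra_simps)
  moreover have "(- real e * \<delta>) * \<alpha> = - real e * \<delta> + 2 * \<delta>"
    using e by (simp add: \<alpha>_def field_simps)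
  ultimately have "(real a' - real b' - (real a - real b), real a' + real b' - (real a + real b))
      = (- real e * \<delta>) *\<^sub>R (1, \<alpha>)"
    by (simp add: \<delta>_def algebra_simps)
  also have "\<dots> = (- real e * \<delta> * s) *\<^sub>R v_dir \<alpha>"
    using \<open>s > 0\<close> by (simp add: v_dir_def s_def)
  finally have shift: "(real a' - real b' - (real a - real b), real a' + real b' - (real a + real b))
      = (- real e * \<delta> * s) *\<^sub>R v_dir \<alpha>" .
  show ?thesis
    by (rule that[of "- real e * \<delta> * s"]) (simp only: node_square_translate[of a' b' a b] shift \<alpha>_def)
qed

lemma two_nat_intervals_meet:
  assumes "(a::nat) \<noteq> a'" "2 * real a - 2 \<le> s" "s \<le> 2 * real a" "2 * real a' - 2 \<le> s" "s \<le> 2 * real a'"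
  shows "s = 2 * real (min a a')"
proof (cases "a < a'")
  case True
  then have "real a + 1 \<le> real a'" by linarith
  then show ?thesis using assms True by simp
next
  case False
  then have "real a' + 1 \<le> real a" using assms(1) by linarith
  then show ?thesis using assms False by simp
qed

lemma node_square_Int_subset_hyperplane:
  assumes "q \<noteq> q'"
  obtains w k where "w = (1,1) \<or> w = (-1,1)" "node_square q \<inter> node_square q' \<subseteq> {z. inner w z = k}"
proof -
  obtain a b a' b' where q: "q = (a,b)" "q' = (a',b')" by fastforce
  show ?thesis
  proof (cases "a = a'")
    case False
    have "node_square q \<inter> node_square q' \<subseteq> {z. inner (1,1) z = 2 * real (min a a')}"
      using two_nat_intervals_meet[OF False] by (auto simp: q node_square_iff)
    then show ?thesis using that by blast
  next
    case True
    then have "b \<noteq> b'" using assms q by simp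
    have "node_square q \<inter> node_square q' \<subseteq> {z. inner (-1,1) z = 2 * real (min b b')}"
      using two_nat_intervals_meet[OF \<open>b \<noteq> b'\<close>] by (auto simp: q node_square_iff)
    then show ?thesis using that by blast
  qed
qed

text \<open>Two distinct node squares meet in a subset of a diagonal line, which a non-diagonal line
  crosses only once.\<close>
lemma negligible_line_section_node_square_Int:
  assumes "\<bar>\<alpha>\<bar> < 1" "q \<noteq> q'"
  shows "negligible (line_section p (v_dir \<alpha>) (node_square q \<inter> node_square q'))"
proof -
  obtain w k where w: "w = (1,1) \<or> w = (-1,1)" and sub: "node_square q \<inter> node_square q' \<subseteq> {z. inner w z = k}"
    using node_square_Int_subset_hyperplane[OF assms(2)] .
  have "0 < sqrt (1 + \<alpha>\<^sup>2)" by (simp add: add_pos_nonneg)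
  then have "inner w (v_dir \<alpha>) \<noteq> 0"
    using w assms(1) by (auto simp: v_dir_def abs_less_iff field_simps)
  then have "line_section p (v_dir \<alpha>) {z. inner w z = k} = {(k - inner w p) / inner w (v_dir \<alpha>)}"
    by (rule line_section_hyperplane)
  moreover have "line_section p (v_dir \<alpha>) (node_square q \<inter> node_square q')
      \<subseteq> line_section p (v_dir \<alpha>) {z. inner w z = k}"
    using sub by (auto simp: line_section_def)
  ultimately show ?thesis by (metis finite.emptyI finite_insert negligible_finite negligible_subset)
qed

lemma abs_shaking_slope: "e \<ge> 2 \<Longrightarrow> \<bar>1 - 2 / real e\<bar> < 1"
  by (auto simp: abs_less_iff field_simps)

lemma line_section_node_square_ladder:
  assumes e: "e \<ge> 2" and "1 \<le> a" "1 \<le> b"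
  obtains \<mu> where "line_section p (v_dir (1 - 2 / real e)) (node_square (a,b))
      = (+) \<mu> ` line_section p (v_dir (1 - 2 / real e)) (node_square (ladder e (a,b), 1))"
proof -
  have "ladder e (ladder e (a,b), 1) = ladder e (a,b)" by (simp add: ladder_Pair)
  then obtain \<mu> where "node_square (a,b)
      = (+) (\<mu> *\<^sub>R v_dir (1 - 2 / real e)) ` node_square (ladder e (a,b), 1)"
    using node_square_ladder_translate[OF e le_refl \<open>1 \<le> b\<close>] by blast
  then show ?thesis using that by (simp add: line_section_translate)
qed

lemma measure_line_section_node_squares:
  assumes e: "e \<ge> 2" and Y: "finite Y" "Y \<subseteq> {(a,b). 1 \<le> a \<and> 1 \<le> b}"
  defines "v \<equiv> v_dir (1 - 2 / real e)"
  shows "measure lebesgue (line_section p v (\<Union>q\<in>Y. node_square q))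
    = (\<Sum>L\<in>ladder e ` Y. real (ladder_count e Y L) * measure lebesgue (line_section p v (node_square (L,1))))"
proof -
  define m where "m q = measure lebesgue (line_section p v (node_square q))" for q
  have "0 < fst v" by (simp add: v_def v_dir_def add_pos_nonneg)
  then have "v \<noteq> 0" by (metis fst_zero order_less_irrefl)
  have translate: "m q = m (ladder e q, 1)" if "q \<in> Y" for q
  proof -
    obtain a b where q: "q = (a,b)" "1 \<le> a" "1 \<le> b" using \<open>q \<in> Y\<close> Y(2) by blast
    obtain \<mu> where "line_section p v (node_square (a,b)) = (+) \<mu> ` line_section p v (node_square (ladder e (a,b), 1))"
      using line_section_node_square_ladder[OF e q(2,3), of p] unfolding v_def by blast
    then show ?thesis by (simp add: m_def q measure_translation)
  qed
  have "line_section p v (\<Union>q\<in>Y. node_square q) = (\<Union>q\<in>Y. line_section p v (node_square q))"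
    by (auto simp: line_section_def)
  then have "measure lebesgue (line_section p v (\<Union>q\<in>Y. node_square q)) = (\<Sum>q\<in>Y. m q)"
    unfolding m_def
  proof (simp only:, intro measure_negligible_finite_Union_image[OF Y(1)])
    show "line_section p v (node_square q) \<in> lmeasurable" for q
      using compact_line_section[OF compact_node_square \<open>v \<noteq> 0\<close>] by (rule lmeasurable_compact)
    show "pairwise (\<lambda>q q'. negligible (line_section p v (node_square q) \<inter> line_section p v (node_square q'))) Y"
      using negligible_line_section_node_square_Int[OF abs_shaking_slope[OF e]]
      by (auto simp: pairwise_def v_def line_section_def Int_def)
  qed
  also have "\<dots> = (\<Sum>q\<in>Y. m (ladder e q, 1))" using translate by simp
  also have "\<dots> = (\<Sum>L\<in>ladder e ` Y. \<Sum>q\<in>{q\<in>Y. ladder e q = L}. m (ladder e q, 1))"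
    by (rule sum.image_gen[OF Y(1)])
  also have "\<dots> = (\<Sum>L\<in>ladder e ` Y. real (ladder_count e Y L) * m (L,1))"
    by (intro sum.cong) (simp_all add: ladder_count_def)
  finally show ?thesis by (simp add: m_def)
qed

lemma line_section_node_squares_empty_iff:
  assumes e: "e \<ge> 2" and Y: "Y \<subseteq> {(a,b). 1 \<le> a \<and> 1 \<le> b}"
  defines "v \<equiv> v_dir (1 - 2 / real e)"
  shows "line_section p v (\<Union>q\<in>Y. node_square q) = {}
    \<longleftrightarrow> (\<forall>L\<in>ladder e ` Y. line_section p v (node_square (L,1)) = {})"
proof -
  have "line_section p v (node_square q) = {} \<longleftrightarrow> line_section p v (node_square (ladder e q, 1)) = {}"
    if "q \<in> Y" for q
  proof -
    obtain a b where q: "q = (a,b)" "1 \<le> a" "1 \<le> b" using \<open>q \<in> Y\<close> Y by blast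
    obtain \<mu> where "line_section p v (node_square (a,b)) = (+) \<mu> ` line_section p v (node_square (ladder e (a,b), 1))"
      using line_section_node_square_ladder[OF e q(2,3), of p] unfolding v_def by blast
    then show ?thesis by (simp add: q)
  qed
  then show ?thesis by (auto simp: line_section_def)
qed

lemma sh_Union_node_square_eq:
  assumes e: "e \<ge> 2" and Y: "finite Y" "Y \<subseteq> {(a,b). 1 \<le> a \<and> 1 \<le> b}"
    and Y': "finite Y'" "Y' \<subseteq> {(a,b). 1 \<le> a \<and> 1 \<le> b}"
    and count: "\<And>L. ladder_count e Y L = ladder_count e Y' L"
  shows "sh e (\<Union>q\<in>Y. node_square q) = sh e (\<Union>q\<in>Y'. node_square q)"
proof -
  have "ladder e ` Y = ladder e ` Y'"
    using count by (simp add: ladder_image_eq Y(1) Y'(1))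
  then show ?thesis
    unfolding sh_def
  proof (intro Sh_cong)
    fix p
    show "line_section p (v_dir (1 - 2 / real e)) (\<Union>q\<in>Y. node_square q) = {}
      \<longleftrightarrow> line_section p (v_dir (1 - 2 / real e)) (\<Union>q\<in>Y'. node_square q) = {}"
      unfolding line_section_node_squares_empty_iff[OF e Y(2)] line_section_node_squares_empty_iff[OF e Y'(2)]
        \<open>ladder e ` Y = ladder e ` Y'\<close> ..
    show "measure lebesgue (line_section p (v_dir (1 - 2 / real e)) (\<Union>q\<in>Y. node_square q))
      = measure lebesgue (line_section p (v_dir (1 - 2 / real e)) (\<Union>q\<in>Y'. node_square q))"
      unfolding measure_line_section_node_squares[OF e Y] measure_line_section_node_squares[OF e Y']
        \<open>ladder e ` Y = ladder e ` Y'\<close> count ..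
  qed
qed

lemma sh_gr_omega_reg_nodes:
  assumes e: "e \<ge> 2" and Y: "down_closed Y" "finite Y" "Y \<noteq> {}"
  shows "sh e (gr (omega_nodes (reg_nodes e Y))) = sh e (gr (omega_nodes Y))"
proof -
  have R: "down_closed (reg_nodes e Y)" "finite (reg_nodes e Y)" "reg_nodes e Y \<noteq> {}"
    using down_closed_reg_nodes[OF e Y(1)] finite_reg_nodes[OF e Y(1,2)] reg_nodes_nonempty[OF e Y] .
  show ?thesis
    unfolding gr_omega_nodes[OF Y] gr_omega_nodes[OF R]
    by (rule sh_Union_node_square_eq[OF e R(2) down_closed_positive[OF R(1)] Y(2) down_closed_positive[OF Y(1)]])
      (rule ladder_count_reg_nodes[OF e down_closed_positive[OF Y(1)]])
qed

lemma sh_gr_omega_tilde_nodes: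
  assumes "0 < n" and Y: "down_closed Y" "finite Y" "Y \<noteq> {}"
  shows "sh e (gr (omega_tilde_nodes n Y)) = (*\<^sub>R) (1 / sqrt (real n)) ` sh e (gr (omega_nodes Y))"
proof -
  define c where "c = 1 / sqrt (real n)"
  have "0 < c" using assms(1) by (simp add: c_def)
  have "omega_tilde_nodes n Y = (\<lambda>x. c * omega_nodes Y (x / c))"
    by (simp add: fun_eq_iff omega_tilde_nodes_def c_def)
  then have "sh e (gr (omega_tilde_nodes n Y)) = (*\<^sub>R) c ` sh e (gr (omega_nodes Y))"
    using gr_dilate_omega_nodes[OF Y \<open>0 < c\<close>] Sh_dilate[OF \<open>0 < c\<close>] by (simp add: sh_def)
  then show ?thesis by (simp add: c_def)
qed

theorem lemma5p1:
  fixes e n :: nat and lam :: "nat list"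
  assumes "e \<ge> 2" and "is_partition lam n" and "lam \<noteq> []"
  shows "sh e (gr (omega lam)) = sh e (gr (omega_nodes (reg_nodes e (young lam))))
    \<and> sh e (gr (omega_tilde n lam)) = sh e (gr (omega_tilde_nodes n (reg_nodes e (young lam))))"
proof -
  define Y where "Y = young lam"
  define R where "R = reg_nodes e Y"
  have Y: "down_closed Y" "finite Y" "Y \<noteq> {}"
    using down_closed_young[OF assms(2)] finite_young young_nonempty[OF assms(2,3)] by (simp_all add: Y_def)
  have R: "down_closed R" "finite R" "R \<noteq> {}"
    using down_closed_reg_nodes[OF assms(1) Y(1)] finite_reg_nodes[OF assms(1) Y(1,2)]
      reg_nodes_nonempty[OF assms(1) Y] by (simp_all add: R_def)
  have "sh e (gr (omega_nodes Y)) = sh e (gr (omega_nodes R))"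
    using sh_gr_omega_reg_nodes[OF assms(1) Y] by (simp add: R_def)
  then show ?thesis
    using sh_gr_omega_tilde_nodes[OF partition_size_pos[OF assms(2,3)]] Y R
    by (simp add: omega_def omega_tilde_def Y_def R_def)
qed

end
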